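(* Let $k\geq 1$ be an integer and let $n=2k-1$. The maximum size (number of member sets) of an intersecting temperate family on $[n]$ is $$\binom{2k-1}{k} + \binom{2k-1}{k+1}.$$
   Context: $[n]=\{1,\ldots,n\}$, and $\mathcal{P}(X)$ denotes the power set of $X$. A family on $[n]$ is a subset $\mathcal{F}\subseteq \mathcal{P}([n])$. For a family $\mathcal{F}\subseteq\mathcal{P}([n])$ and a set $A\in\mathcal{P}([n])$, let $\mu_{\mathcal{F}}(A)=|\mathcal{P}(A)\cap\mathcal{F}|$. The family $\mathcal{F}$ is called temperate if $\mu_{\mathcal{F}}(A)\leq 1+|A|$ for all $A\in\mathcal{F}$. A family is intersecting if the intersection of any two (not necessarily distinct) elements of it is non-empty; in particular, an intersecting family does not contain the empty set. Convention: $\binom{a}{b}=0$ if $b>a$. *)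

theory Defs
  imports Complex_Main
begin

definition family_on :: "nat \<Rightarrow> nat set set \<Rightarrow> bool" where
  "family_on n F \<longleftrightarrow> F \<subseteq> Pow {1..n}"

definition \<mu> :: "'a set set \<Rightarrow> 'a set \<Rightarrow> nat" where
  "\<mu> F A = card (Pow A \<inter> F)"

definition temperate :: "'a set set \<Rightarrow> bool" where
  "temperate F \<longleftrightarrow> (\<forall>A\<in>F. \<mu> F A \<le> 1 + card A)"

(* A = B is allowed, so an intersecting family does not contain the empty set. *)
definition intersecting :: "'a set set \<Rightarrow> bool" where
  "intersecting F \<longleftrightarrow> (\<forall>A\<in>F. \<forall>B\<in>F. A \<inter> B \<noteq> {})"

end

theory Submission
  imports Defs
begin

text \<open>
  The lower bound is given by all sets of sizes \<open>k\<close> and \<open>k + 1\<close>: two sets of more than \<open>n / 2\<close>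
  elements meet, and a set of size \<open>k + 1\<close> contains only itself and its \<open>k + 1\<close> subsets of
  size \<open>k\<close>.

  For the upper bound, consider the expected number \<open>L S\<close> of members of the family on a random
  maximal chain of subsets of \<open>S\<close>; a set \<open>A \<subseteq> S\<close> lies on such a chain with probability
  \<open>1 / (card S choose card A)\<close>. Reading a chain of subsets of \<open>{1..n}\<close> from the top down, stop at
  the first member \<open>A\<close> that it meets. The rest of the chain is a random maximal chain below \<open>A\<close>,
  and each of the at most \<open>card A\<close> proper nonempty subsets of \<open>A\<close> in the family lies on it with
  probability at most \<open>1 / card A\<close>. So at most one further member is expected, which gives the
  inequality \<open>L {1..n} \<le> 2\<close> of LYM type (lemma \<open>temperate_LYM\<close>).

  This inequality alone allows the two middle layers \<open>k - 1\<close> and \<open>k\<close> to be full. For an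
  intersecting family, however, these two layers together contain at most one of each pair
  of complementary sets, hence at most \<open>n choose k\<close> members
  (lemma \<open>intersecting_complementary_layers\<close>). The layers \<open>i\<close> and
  \<open>n - i\<close> enter the inequality with the same weight, so the middle pair can use up at most one
  unit of the total weight 2; every remaining member has
  weight at least \<open>1 / (n choose (k + 1))\<close>, which bounds their number.
\<close>

section \<open>An inequality of LYM type for temperate families\<close>

definition chain_weight :: "'a set set \<Rightarrow> 'a set \<Rightarrow> real" where
  "chain_weight F S = (\<Sum>A\<in>Pow S \<inter> F. 1 / real (card S choose card A))"

text \<open>
  A random maximal chain below a set outside the family continues below a random one of its
  subsets of codimension one.
\<close>

lemma chain_weight_average:
  assumes fin: "finite S" and notin: "S \<notin> F"
  shows "real (card S) * chain_weight F S = (\<Sum>x\<in>S. chain_weight F (S - {x}))"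
proof -
  let ?n = "card S"
  have "(\<Sum>x\<in>S. chain_weight F (S - {x}))
      = (\<Sum>x\<in>S. \<Sum>A | A \<in> Pow S \<inter> F \<and> x \<notin> A. 1 / real (?n - 1 choose card A))"
    unfolding chain_weight_def
    by (intro sum.cong refl) (auto simp: fin)
  also have "\<dots> = (\<Sum>A\<in>Pow S \<inter> F. \<Sum>x | x \<in> S \<and> x \<notin> A. 1 / real (?n - 1 choose card A))"
    using fin by (intro sum.swap_restrict) auto
  also have "\<dots> = (\<Sum>A\<in>Pow S \<inter> F. real ?n * (1 / real (?n choose card A)))"
  proof (intro sum.cong refl)
    fix A assume A: "A \<in> Pow S \<inter> F"
    then have "A \<subset> S" using notin by auto
    then have less: "card A < ?n" using fin by (simp add: psubset_card_mono)
    have "{x \<in> S. x \<notin> A} = S - A" by auto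
    then have "card {x \<in> S. x \<notin> A} = ?n - card A"
      using A fin by (metis IntD1 PowD card_Diff_subset finite_subset)
    moreover have "real (?n - card A) * real (?n choose card A)
        = real ?n * real (?n - 1 choose card A)"
      using binomial_absorb_comp[of ?n "card A"] by (metis of_nat_mult)
    moreover have "?n choose card A > 0" "?n - 1 choose card A > 0"
      using less by auto
    ultimately show "(\<Sum>x | x \<in> S \<and> x \<notin> A. 1 / real (?n - 1 choose card A))
        = real ?n * (1 / real (?n choose card A))"
      by (simp add: field_simps)
  qed
  also have "\<dots> = real ?n * chain_weight F S"
    by (simp add: chain_weight_def sum_distrib_left)
  finally show ?thesis by simp
qed

lemma le_binomial_interior:
  fixes m i :: nat
  assumes "0 < i" "i < m"
  shows "m \<le> m choose i"
proof (cases "i \<le> m div 2")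
  case True
  then show ?thesis using binomial_mono[of 1 i m] assms by simp
next
  case False
  then have "m choose (m - i) \<ge> m choose 1"
    using assms by (intro binomial_mono) auto
  then show ?thesis using assms by (simp add: binomial_symmetric[of i m])
qed

text \<open>
  For a member \<open>A\<close>, temperateness leaves at most \<open>card A\<close> proper subsets in the family. Each of
  them is nonempty, so it lies on a random maximal chain below \<open>A\<close> with probability at most
  \<open>1 / card A\<close>. The set \<open>A\<close> itself contributes 1.
\<close>

lemma chain_weight_member:
  assumes temp: "temperate F" and empty: "{} \<notin> F" and mem: "A \<in> F" and fin: "finite A"
  shows "chain_weight F A \<le> 2"
proof -
  let ?P = "Pow A \<inter> F - {A}"
  have pos: "card A > 0" using mem empty fin by (auto simp: card_gt_0_iff)
  have "card (Pow A \<inter> F) \<le> 1 + card A"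
    using temp mem by (auto simp: temperate_def \<mu>_def)
  then have cardP: "card ?P \<le> card A"
    using mem fin by (simp add: card_Diff_singleton)
  have "chain_weight F A
      = 1 / real (card A choose card A) + (\<Sum>B\<in>?P. 1 / real (card A choose card B))"
    unfolding chain_weight_def using mem fin by (intro sum.remove) auto
  also have "(\<Sum>B\<in>?P. 1 / real (card A choose card B)) \<le> (\<Sum>B\<in>?P. 1 / real (card A))"
  proof (intro sum_mono)
    fix B assume B: "B \<in> ?P"
    then have "finite B" "B \<subset> A" "B \<noteq> {}" using fin finite_subset empty by auto
    then have "card A \<le> card A choose card B"
      using fin by (intro le_binomial_interior) (auto simp: card_gt_0_iff psubset_card_mono)
    then show "1 / real (card A choose card B) \<le> 1 / real (card A)"
      using pos by (simp add: frac_le)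
  qed
  also have "(\<Sum>B\<in>?P. 1 / real (card A)) \<le> 1"
    using cardP pos by (simp add: divide_le_eq)
  finally show ?thesis by simp
qed

text \<open>
  Conditioning on the first member that a descending chain meets becomes an induction on the
  ground set: outside the family average over the next step, in the family stop.
\<close>

lemma temperate_LYM:
  assumes temp: "temperate F" and empty: "{} \<notin> F" and "finite S"
  shows "chain_weight F S \<le> 2"
  using \<open>finite S\<close>
proof (induction S rule: finite_psubset_induct)
  case (psubset S)
  show ?case
  proof (cases "S \<in> F")
    case True
    then show ?thesis using chain_weight_member temp empty psubset.hyps by blast
  next
    case False
    show ?thesis
    proof (cases "S = {}")
      case True
      then show ?thesis using False by (simp add: chain_weight_def)
    next
      case nonempty: False
      have "real (card S) * chain_weight F S = (\<Sum>x\<in>S. chain_weight F (S - {x}))"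
        using chain_weight_average psubset.hyps False by blast
      also have "\<dots> \<le> (\<Sum>x\<in>S. 2)"
        by (intro sum_mono psubset.IH) auto
      also have "\<dots> = real (card S) * 2" by simp
      finally show ?thesis
        using nonempty psubset.hyps by (simp add: card_gt_0_iff)
    qed
  qed
qed

section \<open>The upper bound\<close>

text \<open>
  Complementation sends members of size \<open>i\<close> to sets of size \<open>n - i\<close>, none of which is a member.
\<close>

lemma intersecting_complementary_layers:
  assumes fam: "family_on n F" and inter: "intersecting F" and i: "i \<le> n"
  shows "card {A \<in> F. card A = i \<or> card A = n - i} \<le> n choose i"
proof -
  let ?U = "{1..n}"
  let ?X = "{A \<in> F. card A = i}" and ?Y = "{A \<in> F. card A = n - i}"
  have sub: "A \<subseteq> ?U" if "A \<in> F" for A using that fam by (auto simp: family_on_def)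
  have finF: "finite F" using fam by (auto simp: family_on_def intro: finite_subset)
  have inj: "inj_on (\<lambda>A. ?U - A) ?Y"
    by (rule inj_onI) (metis (lifting) double_diff order_refl mem_Collect_eq sub)
  have disj: "?X \<inter> (\<lambda>A. ?U - A) ` ?Y = {}"
    using inter by (auto simp: intersecting_def)
  have comp: "?U - A \<subseteq> ?U" "card (?U - A) = i" if "A \<in> ?Y" for A
    using that sub[of A] i by (auto simp: card_Diff_subset finite_subset)
  have "{A \<in> F. card A = i \<or> card A = n - i} = ?X \<union> ?Y" by auto
  then have "card {A \<in> F. card A = i \<or> card A = n - i} \<le> card ?X + card ?Y"
    by (simp add: card_Un_le)
  also have "\<dots> = card (?X \<union> (\<lambda>A. ?U - A) ` ?Y)"
    using finF disj inj by (subst card_Un_disjoint) (auto simp: card_image)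
  also have "\<dots> \<le> card {A. A \<subseteq> ?U \<and> card A = i}"
    using sub comp by (intro card_mono) auto
  also have "\<dots> = n choose i" by (simp add: n_subsets)
  finally show ?thesis .
qed

lemma binomial_outside_middle:
  fixes i k :: nat
  assumes "k \<ge> 1" "i \<le> 2 * k - 1" "i \<noteq> k" "i \<noteq> k - 1"
  shows "2 * k - 1 choose i \<le> 2 * k - 1 choose (k + 1)"
proof (cases "i > k")
  case True
  then show ?thesis using assms by (intro binomial_antimono) auto
next
  case False
  have "2 * k - 1 choose (2 * k - 1 - i) \<le> 2 * k - 1 choose (k + 1)"
    using assms False by (intro binomial_antimono) auto
  then show ?thesis using assms by (simp add: binomial_symmetric[of i])
qed

lemma intersecting_temperate_card_le:
  assumes k: "k \<ge> 1" and n: "n = 2 * k - 1"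
    and fam: "family_on n F" and inter: "intersecting F" and temp: "temperate F"
  shows "card F \<le> (n choose k) + (n choose (k + 1))"
proof -
  let ?c = "real (n choose k)" and ?d = "real (n choose (k + 1))"
  let ?w = "\<lambda>A::nat set. 1 / real (n choose card A)"
  define M where "M = {A \<in> F. card A = k \<or> card A = n - k}"
  define R where "R = F - M"
  have finF: "finite F" using fam by (auto simp: family_on_def intro: finite_subset)
  have MF: "M \<subseteq> F" and fin: "finite M" "finite R"
    using finF by (auto simp: M_def R_def)
  have empty: "{} \<notin> F" using inter by (auto simp: intersecting_def)
  have cpos: "?c > 0" using k n by simp
  have "Pow {1..n} \<inter> F = F" using fam by (auto simp: family_on_def)
  then have "sum ?w F \<le> 2"
    using temperate_LYM[OF temp empty, of "{1..n}"] by (simp add: chain_weight_def)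
  moreover have "sum ?w F = sum ?w M + sum ?w R"
    unfolding R_def using finF MF by (metis add.commute sum.subset_diff)
  moreover have "sum ?w M = real (card M) / ?c"
  proof -
    have "sum ?w M = (\<Sum>A\<in>M. 1 / ?c)"
      using k n binomial_symmetric[of k n] by (intro sum.cong) (auto simp: M_def)
    then show ?thesis by simp
  qed
  ultimately have wR: "sum ?w R \<le> 2 - real (card M) / ?c" by simp
  have "real (card R) = (\<Sum>A\<in>R. 1)" by simp
  also have "\<dots> \<le> (\<Sum>A\<in>R. ?d * ?w A)"
  proof (intro sum_mono)
    fix A assume A: "A \<in> R"
    then have "A \<subseteq> {1..n}" using fam by (auto simp: R_def family_on_def)
    then have le: "card A \<le> n" using card_mono[of "{1..n}" A] by simp
    have "card A \<noteq> k" "card A \<noteq> k - 1" using A k n by (auto simp: R_def M_def)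
    then have "n choose card A \<le> n choose (k + 1)"
      using binomial_outside_middle k le n by simp
    then show "1 \<le> ?d * ?w A" using le by simp
  qed
  also have "\<dots> = ?d * sum ?w R" by (simp add: sum_distrib_left)
  also have "\<dots> \<le> ?d * (2 - real (card M) / ?c)"
    using wR by (intro mult_left_mono) auto
  finally have R: "real (card R) \<le> ?d * (2 - real (card M) / ?c)" .
  have "card M \<le> n choose k"
    unfolding M_def using k n by (intro intersecting_complementary_layers[OF fam inter]) arith+
  moreover have "n choose (k + 1) \<le> n choose k"
  proof (cases "k + 1 \<le> n")
    case True
    then show ?thesis using n by (intro binomial_antimono) auto
  next
    case False
    then show ?thesis by (simp add: binomial_eq_0)
  qed
  \<comment> \<open>A middle member costs weight \<open>1 / ?c\<close>, at most what any other member costs, so the bound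
    \<open>card M + ?d * (2 - card M / ?c)\<close> on \<open>card F\<close> increases with \<open>card M\<close> and is largest at
    \<open>card M = ?c\<close>. The product below is the difference to that value, times \<open>?c\<close>.\<close>
  ultimately have "0 \<le> (?c - real (card M)) * (?c - ?d)" by simp
  then have "real (card M) + ?d * (2 - real (card M) / ?c) \<le> ?c + ?d"
    using cpos by (simp add: field_simps)
  moreover have "card F = card M + card R"
    unfolding R_def using finF MF by (simp add: card_Diff_subset card_mono fin)
  ultimately have "real (card F) \<le> ?c + ?d" using R by simp
  then show ?thesis by linarith
qed

section \<open>Extremality of two consecutive layers\<close>

lemma two_layers_extremal:
  fixes k n :: nat
  assumes k: "k \<ge> 1" and n: "n = 2 * k - 1"
  defines "F \<equiv> {A. A \<subseteq> {1..n} \<and> card A = k} \<union> {A. A \<subseteq> {1..n} \<and> card A = k + 1}"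
  shows "family_on n F" "intersecting F" "temperate F"
    and "card F = (n choose k) + (n choose (k + 1))"
proof -
  show "family_on n F" by (auto simp: F_def family_on_def)
  show "intersecting F"
    unfolding intersecting_def
  proof (intro ballI notI)
    fix A B assume AB: "A \<in> F" "B \<in> F" "A \<inter> B = {}"
    then have sub: "A \<subseteq> {1..n}" "B \<subseteq> {1..n}" and big: "card A \<ge> k" "card B \<ge> k"
      by (auto simp: F_def)
    have "card A + card B = card (A \<union> B)"
      using AB(3) sub by (simp add: card_Un_disjoint finite_subset[of _ "{1..n}"])
    also have "\<dots> \<le> n" using card_mono[of "{1..n}" "A \<union> B"] sub by simp
    finally show False using big k n by simp
  qed
  show "temperate F"
    unfolding temperate_def \<mu>_def
  proof
    fix A assume A: "A \<in> F"
    then have finA: "finite A" by (auto simp: F_def intro: finite_subset)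
    \<comment> \<open>Besides \<open>A\<close> itself only subsets of size \<open>k\<close> can be members; there are \<open>card A\<close> of
      them if \<open>card A = k + 1\<close>, and one, namely \<open>A\<close>, if \<open>card A = k\<close>.\<close>
    have "Pow A \<inter> F \<subseteq> insert A {B. B \<subseteq> A \<and> card B = k}"
    proof
      fix B assume B: "B \<in> Pow A \<inter> F"
      show "B \<in> insert A {B. B \<subseteq> A \<and> card B = k}"
      proof (cases "card B = k")
        case False
        then have "card A \<le> card B" using A B by (auto simp: F_def)
        then have "B = A" using B finA by (intro card_seteq) auto
        then show ?thesis by simp
      qed (use B in auto)
    qed
    then have "card (Pow A \<inter> F) \<le> card (insert A {B. B \<subseteq> A \<and> card B = k})"
      using finA by (intro card_mono) auto
    also have "\<dots> \<le> 1 + (card A choose k)"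
      using n_subsets[OF finA, of k] finA
      by (simp add: card_insert_if)
    also have "\<dots> \<le> 1 + card A"
    proof -
      have "card A = k \<or> card A = k + 1" using A by (auto simp: F_def)
      then show ?thesis
      proof
        assume "card A = k"
        then show ?thesis using k by simp
      next
        assume "card A = k + 1"
        then show ?thesis using binomial_symmetric[of k "k + 1"] by simp
      qed
    qed
    finally show "card (Pow A \<inter> F) \<le> 1 + card A" .
  qed
  show "card F = (n choose k) + (n choose (k + 1))"
    unfolding F_def by (subst card_Un_disjoint) (auto simp: n_subsets)
qed

theorem theorem1p5:
  fixes k n :: nat
  assumes "k \<ge> 1" and "n = 2 * k - 1"
  shows "Max {card F |F. family_on n F \<and> intersecting F \<and> temperate F}
           = ((2 * k - 1) choose k) + ((2 * k - 1) choose (k + 1))"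
proof -
  let ?b = "(n choose k) + (n choose (k + 1))"
  let ?S = "{card F |F. family_on n F \<and> intersecting F \<and> temperate F}"
  have upper: "x \<le> ?b" if "x \<in> ?S" for x
    using that intersecting_temperate_card_le[OF assms] by auto
  have "finite ?S" using upper by (intro finite_subset[of ?S "{..?b}"]) auto
  moreover have "?b \<in> ?S"
    by (intro CollectI exI conjI)
      (rule two_layers_extremal(4)[OF assms, symmetric] two_layers_extremal(1-3)[OF assms])+
  ultimately have "Max ?S = ?b" using upper by (intro Max_eqI) auto
  then show ?thesis using assms(2) by simp
qed

end
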